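(* Every strictly categorical, quasi-distributive skew lattice is both distributive and simply cancellative. Moreover, a strictly categorical, quasi-distributive skew lattice is cancellative if and only if it is symmetric.
   Context: A skew lattice is a set $S$ with two associative, idempotent binary operations $\wedge,\vee$ satisfying $x\wedge (x\vee y) = x = (y\vee x)\wedge x$ and $x\vee (x\wedge y) = x = (y\wedge x)\vee x$. It is - distributive if it satisfies both $x\wedge (y\vee z)\wedge x = (x\wedge y\wedge x)\vee (x\wedge z\wedge x)$ and $x\vee (y\wedge z)\vee x = (x\vee y\vee x)\wedge (x\vee z\vee x)$; - symmetric if for all $x,y$: $x\wedge y=y\wedge x$ iff $x\vee y=y\vee x$; - cancellative if for all $x,y,z$: ($x\vee y=x\vee z$ and $x\wedge y=x\wedge z$ imply $y=z$) and ($x\vee z=y\vee z$ and $x\wedge z=y\wedge z$ imply $x=y$); - simply cancellative if for all $x,y,z$: $x\vee z\vee x=y\vee z\vee y$ and $x\wedge z\wedge x=y\wedge z\wedge y$ imply $x=y$; - quasi-distributive if its maximal lattice image $S/\mathcal D$ (defined below) is a distributive lattice. Natural preorder: $a\succeq b$ iff $a\vee b\vee a=a$ (equivalently $b\wedge a\wedge b=b$). Natural partial order: $x\ge y$ iff $x\wedge y=y=y\wedge x$; $x>y$ means $x\ge y$ and $x\ne y$. The relation $a\mathrel{\mathcal D}b$ iff $a\succeq b$ and $b\succeq a$ is a congruence, and $S/\mathcal D$ is the maximal lattice image of $S$; for $\mathcal D$-classes, $A\ge B$ means $a\succeq b$ for $a\in A$, $b\in B$. For $\mathcal D$-classes $A>B$: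 an $A$-coset in $B$ is a set $A\wedge b\wedge A=\{a\wedge b\wedge a'\mid a,a'\in A\}$ with $b\in B$; a $B$-coset in $A$ is a set $B\vee a\vee B=\{b\vee a\vee b'\mid b,b'\in B\}$ with $a\in A$. For a $B$-coset $X$ in $A$ and an $A$-coset $Y$ in $B$, the coset bijection $\varphi:X\to Y$ is given by $\varphi(a)=b$ iff $a\in X$, $b\in Y$, $a>b$; it is regarded as a partial bijection from $A$ to $B$. A skew lattice is categorical if for all chains $A>B>C$ of $\mathcal D$-classes, every nonempty composite $\psi\circ\varphi$ of coset bijections $\varphi$ from $A$ to $B$ and $\psi$ from $B$ to $C$ is a coset bijection from $A$ to $C$. It is strictly categorical if in addition, for every chain of $\mathcal D$-classes $A>B>C$, each $A$-coset in $B$ has nonempty intersection with each $C$-coset in $B$. *)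

theory Defs
  imports Main
begin

text \<open>
  The carrier of a skew lattice is the whole type; a type variable ranges over all
  nonempty carriers.
\<close>

locale skew_lattice =
  fixes meet :: "'a \<Rightarrow> 'a \<Rightarrow> 'a"  (infixl "\<sqinter>" 70)
    and join :: "'a \<Rightarrow> 'a \<Rightarrow> 'a"  (infixl "\<squnion>" 65)
  assumes meet_assoc: "(x \<sqinter> y) \<sqinter> z = x \<sqinter> (y \<sqinter> z)"
    and join_assoc: "(x \<squnion> y) \<squnion> z = x \<squnion> (y \<squnion> z)"
    and meet_idem: "x \<sqinter> x = x"
    and join_idem: "x \<squnion> x = x"
    and meet_join_absorb: "x \<sqinter> (x \<squnion> y) = x"
    and join_meet_absorb_right: "(y \<squnion> x) \<sqinter> x = x"
    and join_meet_absorb: "x \<squnion> (x \<sqinter> y) = x"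
    and meet_join_absorb_right: "(y \<sqinter> x) \<squnion> x = x"

locale distributive_lattice_on =
  fixes L :: "'b set"
    and inf :: "'b \<Rightarrow> 'b \<Rightarrow> 'b"  (infixl "\<sqinter>" 70)
    and sup :: "'b \<Rightarrow> 'b \<Rightarrow> 'b"  (infixl "\<squnion>" 65)
  assumes inf_closed: "\<lbrakk>x \<in> L; y \<in> L\<rbrakk> \<Longrightarrow> x \<sqinter> y \<in> L"
    and sup_closed: "\<lbrakk>x \<in> L; y \<in> L\<rbrakk> \<Longrightarrow> x \<squnion> y \<in> L"
    and inf_assoc: "\<lbrakk>x \<in> L; y \<in> L; z \<in> L\<rbrakk> \<Longrightarrow> (x \<sqinter> y) \<sqinter> z = x \<sqinter> (y \<sqinter> z)"
    and sup_assoc: "\<lbrakk>x \<in> L; y \<in> L; z \<in> L\<rbrakk> \<Longrightarrow> (x \<squnion> y) \<squnion> z = x \<squnion> (y \<squnion> z)"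
    and inf_commute: "\<lbrakk>x \<in> L; y \<in> L\<rbrakk> \<Longrightarrow> x \<sqinter> y = y \<sqinter> x"
    and sup_commute: "\<lbrakk>x \<in> L; y \<in> L\<rbrakk> \<Longrightarrow> x \<squnion> y = y \<squnion> x"
    and inf_sup_absorb: "\<lbrakk>x \<in> L; y \<in> L\<rbrakk> \<Longrightarrow> x \<sqinter> (x \<squnion> y) = x"
    and sup_inf_absorb: "\<lbrakk>x \<in> L; y \<in> L\<rbrakk> \<Longrightarrow> x \<squnion> (x \<sqinter> y) = x"
    and inf_sup_distrib: "\<lbrakk>x \<in> L; y \<in> L; z \<in> L\<rbrakk> \<Longrightarrow> x \<sqinter> (y \<squnion> z) = (x \<sqinter> y) \<squnion> (x \<sqinter> z)"

context skew_lattice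
begin

definition distributive :: bool where
  "distributive \<longleftrightarrow>
     (\<forall>x y z. x \<sqinter> (y \<squnion> z) \<sqinter> x = (x \<sqinter> y \<sqinter> x) \<squnion> (x \<sqinter> z \<sqinter> x)) \<and>
     (\<forall>x y z. x \<squnion> (y \<sqinter> z) \<squnion> x = (x \<squnion> y \<squnion> x) \<sqinter> (x \<squnion> z \<squnion> x))"

definition symmetric :: bool where
  "symmetric \<longleftrightarrow> (\<forall>x y. x \<sqinter> y = y \<sqinter> x \<longleftrightarrow> x \<squnion> y = y \<squnion> x)"

definition cancellative :: bool where
  "cancellative \<longleftrightarrow>
     (\<forall>x y z. (x \<squnion> y = x \<squnion> z \<and> x \<sqinter> y = x \<sqinter> z \<longrightarrow> y = z) \<and>
              (x \<squnion> z = y \<squnion> z \<and> x \<sqinter> z = y \<sqinter> z \<longrightarrow> x = y))"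

definition simply_cancellative :: bool where
  "simply_cancellative \<longleftrightarrow>
     (\<forall>x y z. x \<squnion> z \<squnion> x = y \<squnion> z \<squnion> y \<and> x \<sqinter> z \<sqinter> x = y \<sqinter> z \<sqinter> y \<longrightarrow> x = y)"

definition preord_ge :: "'a \<Rightarrow> 'a \<Rightarrow> bool"  (infix "\<succeq>" 50) where
  "a \<succeq> b \<longleftrightarrow> a \<squnion> b \<squnion> a = a"

definition nat_ge :: "'a \<Rightarrow> 'a \<Rightarrow> bool" where
  "nat_ge x y \<longleftrightarrow> x \<sqinter> y = y \<and> y \<sqinter> x = y"

definition nat_gt :: "'a \<Rightarrow> 'a \<Rightarrow> bool" where
  "nat_gt x y \<longleftrightarrow> nat_ge x y \<and> x \<noteq> y"

definition D :: "('a \<times> 'a) set" where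
  "D = {(a, b). a \<succeq> b \<and> b \<succeq> a}"

abbreviation D_classes :: "'a set set" where
  "D_classes \<equiv> UNIV // D"

text \<open>
  The operations of \<open>S/D\<close>. Since \<open>D\<close> is a congruence, each union below consists of
  copies of a single class; see \<open>class_meet_class\<close> and \<open>class_join_class\<close>.
\<close>

definition class_meet :: "'a set \<Rightarrow> 'a set \<Rightarrow> 'a set" where
  "class_meet A B = (\<Union>a\<in>A. \<Union>b\<in>B. D `` {a \<sqinter> b})"

definition class_join :: "'a set \<Rightarrow> 'a set \<Rightarrow> 'a set" where
  "class_join A B = (\<Union>a\<in>A. \<Union>b\<in>B. D `` {a \<squnion> b})"

definition quasi_distributive :: bool where
  "quasi_distributive \<longleftrightarrow> distributive_lattice_on D_classes class_meet class_join"

definition class_gt :: "'a set \<Rightarrow> 'a set \<Rightarrow> bool" where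
  "class_gt A B \<longleftrightarrow> (\<forall>a\<in>A. \<forall>b\<in>B. a \<succeq> b) \<and> A \<noteq> B"

definition meet_cosets :: "'a set \<Rightarrow> 'a set \<Rightarrow> 'a set set" where
  \<comment> \<open>the \<open>A\<close>-cosets in \<open>B\<close>\<close>
  "meet_cosets A B = {{a \<sqinter> b \<sqinter> a' | a a'. a \<in> A \<and> a' \<in> A} | b. b \<in> B}"

definition join_cosets :: "'a set \<Rightarrow> 'a set \<Rightarrow> 'a set set" where
  \<comment> \<open>the \<open>B\<close>-cosets in \<open>A\<close>\<close>
  "join_cosets B A = {{b \<squnion> a \<squnion> b' | b b'. b \<in> B \<and> b' \<in> B} | a. a \<in> A}"

text \<open>
  A partial bijection is represented by its graph, so the composite \<open>\<psi> \<circ> \<phi>\<close> of partial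
  maps is the relation \<open>\<phi> O \<psi>\<close>.
\<close>

definition coset_bijections :: "'a set \<Rightarrow> 'a set \<Rightarrow> ('a \<times> 'a) set set" where
  "coset_bijections A B =
     {{(a, b). a \<in> X \<and> b \<in> Y \<and> nat_gt a b} | X Y. X \<in> join_cosets B A \<and> Y \<in> meet_cosets A B}"

definition categorical :: bool where
  "categorical \<longleftrightarrow>
     (\<forall>A\<in>D_classes. \<forall>B\<in>D_classes. \<forall>C\<in>D_classes. class_gt A B \<and> class_gt B C \<longrightarrow>
        (\<forall>\<phi>\<in>coset_bijections A B. \<forall>\<psi>\<in>coset_bijections B C.
           \<phi> O \<psi> \<noteq> {} \<longrightarrow> \<phi> O \<psi> \<in> coset_bijections A C))"

definition strictly_categorical :: bool where
  "strictly_categorical \<longleftrightarrow> categorical \<and>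
     (\<forall>A\<in>D_classes. \<forall>B\<in>D_classes. \<forall>C\<in>D_classes. class_gt A B \<and> class_gt B C \<longrightarrow>
        (\<forall>Y\<in>meet_cosets A B. \<forall>Z\<in>join_cosets C B. Y \<inter> Z \<noteq> {}))"

lemma preord_ge_iff_meet: "a \<succeq> b \<longleftrightarrow> b \<sqinter> a \<sqinter> b = b"
proof
  assume "a \<succeq> b"
  hence "a \<squnion> (b \<squnion> a) = a" by (simp add: preord_ge_def join_assoc)
  hence "a \<sqinter> (b \<squnion> a) = b \<squnion> a" by (metis join_meet_absorb_right)
  hence "b = b \<sqinter> a \<sqinter> (b \<squnion> a)" by (metis meet_assoc meet_join_absorb)
  thus "b \<sqinter> a \<sqinter> b = b" by (metis meet_assoc meet_idem)
next
  assume "b \<sqinter> a \<sqinter> b = b"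
  hence "b \<sqinter> (a \<sqinter> b) = b" by (simp add: meet_assoc)
  hence "b \<squnion> (a \<sqinter> b) = a \<sqinter> b" by (metis meet_join_absorb_right)
  hence "a = a \<squnion> b \<squnion> (a \<sqinter> b)" by (metis join_assoc join_meet_absorb)
  thus "a \<succeq> b" unfolding preord_ge_def by (metis join_assoc join_idem)
qed

lemma preord_refl: "a \<succeq> a"
  by (simp add: preord_ge_def join_idem)

lemma preord_trans: "a \<succeq> b \<Longrightarrow> b \<succeq> c \<Longrightarrow> a \<succeq> c"
  unfolding preord_ge_def by (metis join_assoc join_idem)

lemma meet_le1: "a \<succeq> a \<sqinter> b"
  by (simp add: preord_ge_def join_meet_absorb join_idem)

lemma meet_le2: "b \<succeq> a \<sqinter> b"
  unfolding preord_ge_iff_meet by (metis meet_assoc meet_idem)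

lemma meet_greatest: "a \<succeq> c \<Longrightarrow> b \<succeq> c \<Longrightarrow> a \<sqinter> b \<succeq> c"
  unfolding preord_ge_iff_meet by (metis meet_assoc meet_idem)

lemma join_ge1: "a \<squnion> b \<succeq> a"
  by (simp add: preord_ge_iff_meet meet_join_absorb meet_idem)

lemma join_ge2: "a \<squnion> b \<succeq> b"
  unfolding preord_ge_def by (metis join_assoc join_idem)

lemma join_least: "c \<succeq> a \<Longrightarrow> c \<succeq> b \<Longrightarrow> c \<succeq> a \<squnion> b"
  unfolding preord_ge_def by (metis join_assoc join_idem)

lemma D_iff: "(a, b) \<in> D \<longleftrightarrow> a \<succeq> b \<and> b \<succeq> a"
  by (simp add: D_def)

lemma equiv_D: "equiv UNIV D"
  by (rule equivI) (auto simp: refl_on_def sym_def trans_def D_iff intro: preord_refl preord_trans)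

lemma meet_mono: "a \<succeq> a' \<Longrightarrow> b \<succeq> b' \<Longrightarrow> a \<sqinter> b \<succeq> a' \<sqinter> b'"
  by (meson meet_greatest meet_le1 meet_le2 preord_trans)

lemma join_mono: "a \<succeq> a' \<Longrightarrow> b \<succeq> b' \<Longrightarrow> a \<squnion> b \<succeq> a' \<squnion> b'"
  by (meson join_least join_ge1 join_ge2 preord_trans)

lemma D_meet: "(a, a') \<in> D \<Longrightarrow> (b, b') \<in> D \<Longrightarrow> (a \<sqinter> b, a' \<sqinter> b') \<in> D"
  by (simp add: D_iff meet_mono)

lemma D_join: "(a, a') \<in> D \<Longrightarrow> (b, b') \<in> D \<Longrightarrow> (a \<squnion> b, a' \<squnion> b') \<in> D"
  by (simp add: D_iff join_mono)

lemma class_meet_class: "class_meet (D `` {a}) (D `` {b}) = D `` {a \<sqinter> b}"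
  unfolding class_meet_def
  by (rule UN_equiv_class2[OF equiv_D equiv_D])
    (auto simp: congruent2_def intro!: equiv_class_eq[OF equiv_D] D_meet)

lemma class_join_class: "class_join (D `` {a}) (D `` {b}) = D `` {a \<squnion> b}"
  unfolding class_join_def
  by (rule UN_equiv_class2[OF equiv_D equiv_D])
    (auto simp: congruent2_def intro!: equiv_class_eq[OF equiv_D] D_join)

lemma D_class_eq_iff: "D `` {a} = D `` {b} \<longleftrightarrow> a \<succeq> b \<and> b \<succeq> a"
  using eq_equiv_class_iff[OF equiv_D] by (simp add: D_iff)

text \<open>\<open>S/D\<close> is always a lattice, so only the distributive law is a restriction.\<close>

lemma quasi_distributive_iff:
  "quasi_distributive \<longleftrightarrow>
     (\<forall>A\<in>D_classes. \<forall>B\<in>D_classes. \<forall>C\<in>D_classes.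
        class_meet A (class_join B C) = class_join (class_meet A B) (class_meet A C))"
proof
  assume quasi_distributive
  thus "\<forall>A\<in>D_classes. \<forall>B\<in>D_classes. \<forall>C\<in>D_classes.
      class_meet A (class_join B C) = class_join (class_meet A B) (class_meet A C)"
    by (simp add: quasi_distributive_def distributive_lattice_on_def)
next
  assume distrib: "\<forall>A\<in>D_classes. \<forall>B\<in>D_classes. \<forall>C\<in>D_classes.
      class_meet A (class_join B C) = class_join (class_meet A B) (class_meet A C)"
  have inf_comm: "D `` {a \<sqinter> b} = D `` {b \<sqinter> a}" for a b
    unfolding D_class_eq_iff by (simp add: meet_greatest meet_le1 meet_le2)
  have sup_comm: "D `` {a \<squnion> b} = D `` {b \<squnion> a}" for a b
    unfolding D_class_eq_iff by (simp add: join_least join_ge1 join_ge2)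
  show quasi_distributive
    unfolding quasi_distributive_def
  proof (unfold_locales, goal_cases)
    case (9 A B C)
    with distrib show ?case by blast
  qed (elim quotientE, simp add: class_meet_class class_join_class meet_assoc join_assoc
      meet_join_absorb join_meet_absorb quotientI inf_comm sup_comm)+
qed

end

end

theory Submission
  imports Defs
begin

text \<open>
  The whole theorem rests on two properties of \<open>S\<close>. The first is geometric: a \<open>D\<close>-class
  contains at most one element \<open>b\<close> with \<open>a \<ge> b \<ge> c\<close>, for given \<open>a\<close> and \<open>c\<close>. This is what strict
  categoricity provides (\<open>strictly_categorical_middle_unique\<close>): if \<open>b\<close> and \<open>b'\<close> were two
  such elements and \<open>A > B > C\<close> the classes of \<open>a, b, c\<close>, pick \<open>u\<close> in the intersection of the
  \<open>A\<close>-coset of \<open>b\<close> with the \<open>C\<close>-coset of \<open>b'\<close>. Regularity of the bands \<open>(S, \<sqinter>)\<close> and \<open>(S, \<squnion>)\<close>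
  (\<open>meet_regular\<close> and its dual) shows that \<open>q = u \<sqinter> c \<sqinter> u\<close> lies in the same \<open>A\<close>-coset as \<open>c\<close>. The composite of the bijections \<open>a \<mapsto> b' \<mapsto> c\<close> is a full coset bijection, so
  it reaches \<open>q\<close> too, and it can do so only through \<open>u\<close>. Hence \<open>u\<close> lies in the \<open>A\<close>-coset of \<open>b'\<close>,
  and \<open>b = a \<sqinter> u \<sqinter> a = b'\<close>.

  The second property is algebraic: in the distributive lattice \<open>S/D\<close>, the inequalities
  \<open>x \<le> y \<or> z\<close> and \<open>x \<and> z \<le> y\<close> give \<open>x \<le> y\<close>. In this form distributivity is visibly
  self-dual. It serves to show that two elements are \<open>D\<close>-related, so every identity reduces
  to finding a common upper and a common lower bound of its two sides.

  For distributivity the bounds are \<open>x\<close> and \<open>x \<sqinter> z \<sqinter> y \<sqinter> x\<close>, because \<open>y \<squnion> z \<ge> z \<sqinter> y\<close> in every skew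
  lattice. For simple cancellation they are the elements \<open>x \<squnion> z \<squnion> x\<close> and \<open>x \<sqinter> z \<sqinter> x\<close>. To cancel \<open>x\<close> from
  \<open>x \<squnion> y = x \<squnion> z\<close> and \<open>x \<sqinter> y = x \<sqinter> z\<close>, the elements \<open>y\<close> and \<open>z\<close> are first moved below \<open>s = x \<squnion> y\<close>;
  symmetry makes them commute with \<open>s \<sqinter> x\<close>, and this yields a common lower bound.
  That cancellation implies symmetry holds in every skew lattice: when \<open>x\<close> and \<open>y\<close>
  have commuting meets, cancellation shows that both lie below \<open>x \<squnion> y\<close>, so \<open>y \<squnion> x\<close> does too,
  and \<open>x \<squnion> y\<close>, \<open>y \<squnion> x\<close> are \<open>D\<close>-related.
\<close>

section \<open>Duality, mirror images and regularity\<close>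

context skew_lattice
begin

text \<open>
  The axioms are invariant under exchanging the two operations and under reversing the order
  of the arguments of both, so each lemma below is available in up to four versions.
\<close>

lemma dual: "skew_lattice (\<squnion>) (\<sqinter>)"
  by unfold_locales (simp_all add: meet_assoc join_assoc meet_idem join_idem meet_join_absorb
      join_meet_absorb meet_join_absorb_right join_meet_absorb_right)

lemma mirror: "skew_lattice (\<lambda>x y. y \<sqinter> x) (\<lambda>x y. y \<squnion> x)"
  by unfold_locales (simp_all add: meet_assoc join_assoc meet_idem join_idem meet_join_absorb
      join_meet_absorb meet_join_absorb_right join_meet_absorb_right)

lemma meet_left_idem: "x \<sqinter> (x \<sqinter> y) = x \<sqinter> y"
  by (metis meet_assoc meet_idem)

lemma meet_twice_left: "x \<sqinter> (y \<sqinter> (x \<sqinter> y)) = x \<sqinter> y"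
  by (metis meet_assoc meet_idem)

lemma meet_twice_left3: "x \<sqinter> (y \<sqinter> (x \<sqinter> (y \<sqinter> z))) = x \<sqinter> (y \<sqinter> z)"
  by (metis meet_assoc meet_idem)

text \<open>
  The two assumptions say that \<open>u\<close> and \<open>v\<close> are Green-related. In an arbitrary band the conclusion
  can fail; the join enters through \<open>(v \<sqinter> x \<squnion> v) \<sqinter> u\<close>, which collapses to \<open>v\<close>. Multiplying this
  collapse by \<open>v \<sqinter> x\<close>, which absorbs \<open>v \<sqinter> x \<squnion> v\<close>, gives the claim.
\<close>

lemma meet_between_left_related:
  assumes vu: "v \<sqinter> u = v" and uv: "u \<sqinter> v = u"
  shows "v \<sqinter> x \<sqinter> u = v \<sqinter> x \<sqinter> v"
proof -
  define t where "t = v \<sqinter> x"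
  define w where "w = (t \<squnion> v) \<sqinter> u"
  have "v \<sqinter> w = v"
  proof -
    have "v \<sqinter> z \<sqinter> (u \<sqinter> z) = v \<sqinter> z" for z
    proof -
      have "(v \<sqinter> z) \<squnion> (u \<sqinter> z) = u \<sqinter> z"
        using meet_join_absorb_right[of v "u \<sqinter> z"] vu by (simp flip: meet_assoc)
      thus ?thesis by (metis meet_join_absorb)
    qed
    hence star: "v \<sqinter> z \<sqinter> (u \<sqinter> (z \<sqinter> v)) = v \<sqinter> (z \<sqinter> v)" for z
      by (metis meet_assoc)
    have "v \<sqinter> (t \<squnion> v) \<sqinter> (u \<sqinter> ((t \<squnion> v) \<sqinter> v)) = v \<sqinter> ((t \<squnion> v) \<sqinter> v)" by (rule star)
    thus ?thesis
      by (simp add: w_def join_meet_absorb_right meet_idem uv meet_assoc)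
  qed
  hence vw: "v \<squnion> w = w" by (metis meet_join_absorb_right)
  have "v \<squnion> t = v" by (simp add: t_def join_meet_absorb)
  have "v \<squnion> w = v \<squnion> t \<squnion> (v \<squnion> w)"
    using \<open>v \<squnion> t = v\<close> vw by simp
  also have "\<dots> = v \<squnion> ((t \<squnion> v) \<squnion> w)" by (simp only: join_assoc)
  also have "\<dots> = v \<squnion> (t \<squnion> v)" by (simp add: w_def join_meet_absorb)
  also have "\<dots> = v" using \<open>v \<squnion> t = v\<close> by (simp add: join_idem flip: join_assoc)
  finally have "w = v" using vw by simp
  hence "t \<sqinter> v = t \<sqinter> (t \<squnion> v) \<sqinter> u" by (simp add: w_def meet_assoc)
  thus ?thesis by (simp add: meet_join_absorb t_def)
qed

lemma meet_between_right_related: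
  assumes vu: "u \<sqinter> v = v" and uv: "v \<sqinter> u = u"
  shows "u \<sqinter> x \<sqinter> v = v \<sqinter> x \<sqinter> v"
  using skew_lattice.meet_between_left_related[OF mirror, where u=u and v=v and x=x] assms
  by (simp add: meet_assoc)

text \<open>
  The proof compares \<open>xy\<close> with \<open>xyx\<close> and \<open>zx\<close> with \<open>xzx\<close>, which are
  Green-related. Both sides equal \<open>xyzxyxzx\<close>: replacing its initial \<open>xy\<close> by \<open>xyx\<close>
  reduces that word to \<open>xyxzx\<close>, and replacing its final \<open>xzx\<close> by \<open>zx\<close> reduces it to \<open>xyzx\<close>.
\<close>

lemma meet_regular: "x \<sqinter> (y \<sqinter> (x \<sqinter> (z \<sqinter> x))) = x \<sqinter> (y \<sqinter> (z \<sqinter> x))"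
proof -
  have "x \<sqinter> y \<sqinter> z \<sqinter> (x \<sqinter> y \<sqinter> x) = x \<sqinter> y \<sqinter> x \<sqinter> z \<sqinter> (x \<sqinter> y \<sqinter> x)"
    by (rule meet_between_right_related)
      (simp_all add: meet_assoc meet_twice_left meet_twice_left3 meet_left_idem)
  hence "x \<sqinter> y \<sqinter> z \<sqinter> (x \<sqinter> y \<sqinter> x) \<sqinter> (z \<sqinter> x)
      = (x \<sqinter> y \<sqinter> x \<sqinter> z) \<sqinter> (x \<sqinter> y \<sqinter> x \<sqinter> z) \<sqinter> x"
    by (simp add: meet_assoc)
  hence 1: "x \<sqinter> y \<sqinter> (z \<sqinter> x) \<sqinter> y \<sqinter> (x \<sqinter> z \<sqinter> x) = x \<sqinter> y \<sqinter> x \<sqinter> z \<sqinter> x"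
    by (simp only: meet_idem) (simp only: meet_assoc)
  have "z \<sqinter> x \<sqinter> y \<sqinter> (x \<sqinter> z \<sqinter> x) = z \<sqinter> x \<sqinter> y \<sqinter> (z \<sqinter> x)"
    by (rule meet_between_left_related)
      (simp_all add: meet_assoc meet_twice_left meet_twice_left3 meet_left_idem)
  hence "x \<sqinter> y \<sqinter> (z \<sqinter> x) \<sqinter> y \<sqinter> (x \<sqinter> z \<sqinter> x) = (x \<sqinter> y) \<sqinter> (z \<sqinter> (x \<sqinter> (y \<sqinter> (z \<sqinter> x))))"
    by (simp add: meet_assoc)
  also have "\<dots> = (x \<sqinter> y \<sqinter> z) \<sqinter> (x \<sqinter> y \<sqinter> z) \<sqinter> x" by (simp add: meet_assoc)
  also have "\<dots> = x \<sqinter> y \<sqinter> z \<sqinter> x" by (simp only: meet_idem)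
  finally show ?thesis using 1 by (simp add: meet_assoc)
qed

lemmas join_regular = skew_lattice.meet_regular[OF dual]

section \<open>The two orders\<close>

lemma preord_ge_dual: "skew_lattice.preord_ge (\<sqinter>) a b \<longleftrightarrow> b \<succeq> a"
  by (simp add: skew_lattice.preord_ge_def[OF dual] preord_ge_iff_meet)

lemma preord_ge_mirror: "skew_lattice.preord_ge (\<lambda>x y. y \<squnion> x) a b \<longleftrightarrow> a \<succeq> b"
  by (simp add: skew_lattice.preord_ge_def[OF mirror] preord_ge_def join_assoc)

lemma nat_ge_iff_join: "nat_ge x y \<longleftrightarrow> x \<squnion> y = x \<and> y \<squnion> x = x"
  unfolding nat_ge_def
  by (metis join_meet_absorb meet_join_absorb join_meet_absorb_right meet_join_absorb_right)

lemma nat_ge_dual: "skew_lattice.nat_ge (\<squnion>) a b \<longleftrightarrow> nat_ge b a"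
  by (auto simp add: skew_lattice.nat_ge_def[OF dual] nat_ge_iff_join)

lemma nat_ge_mirror: "skew_lattice.nat_ge (\<lambda>x y. y \<sqinter> x) a b \<longleftrightarrow> nat_ge a b"
  by (auto simp add: skew_lattice.nat_ge_def[OF mirror] nat_ge_def)

lemma D_dual: "skew_lattice.D (\<sqinter>) = D"
  by (auto simp: skew_lattice.D_def[OF dual] D_def preord_ge_dual)

lemma nat_ge_imp_preord: "nat_ge a b \<Longrightarrow> a \<succeq> b"
  by (simp add: nat_ge_iff_join preord_ge_def join_idem)

lemma nat_ge_trans: "nat_ge a b \<Longrightarrow> nat_ge b c \<Longrightarrow> nat_ge a c"
  unfolding nat_ge_def by (metis meet_assoc)

lemma nat_ge_preord_eq: "nat_ge a b \<Longrightarrow> b \<succeq> a \<Longrightarrow> a = b"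
  unfolding nat_ge_def preord_ge_iff_meet by metis

lemma nat_ge_join_least: "nat_ge s x \<Longrightarrow> nat_ge s y \<Longrightarrow> nat_ge s (x \<squnion> y)"
  unfolding nat_ge_iff_join by (metis join_assoc)

lemma nat_ge_join_conj: "nat_ge (x \<squnion> y \<squnion> x) x"
  unfolding nat_ge_iff_join by (metis join_assoc join_idem)

lemma nat_ge_meet_conj: "nat_ge x (x \<sqinter> y \<sqinter> x)"
  unfolding nat_ge_def by (metis meet_assoc meet_idem)

lemma D_meet_sandwich: "a \<succeq> b \<Longrightarrow> b \<succeq> a \<Longrightarrow> a \<sqinter> b \<sqinter> a = a"
  by (simp add: preord_ge_iff_meet)

section \<open>Cosets and coset bijections\<close>

text \<open>
  Conjugation by one fixed \<open>a\<close> decides coset membership. Conversely, the conjugating element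
  that exhibits \<open>d\<close> as a member is \<open>d \<squnion> a \<squnion> d\<close>, an element of the class of \<open>a\<close> lying above \<open>d\<close>.
\<close>

lemma meet_coset_eq:
  assumes ab: "a \<succeq> b"
  shows "{x \<sqinter> b \<sqinter> y | x y. x \<in> D `` {a} \<and> y \<in> D `` {a}}
    = {d. (d, b) \<in> D \<and> a \<sqinter> d \<sqinter> a = a \<sqinter> b \<sqinter> a}" (is "?L = ?R")
proof
  show "?L \<subseteq> ?R"
  proof clarify
    fix x y assume xy: "(a, x) \<in> D" "(a, y) \<in> D"
    hence "x \<succeq> b" "y \<succeq> b" using ab by (auto simp: D_iff intro: preord_trans)
    hence "(x \<sqinter> b \<sqinter> y, b) \<in> D"
      by (simp add: D_iff meet_greatest preord_refl) (meson meet_le1 meet_le2 preord_trans)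
    moreover have "a \<sqinter> (x \<sqinter> b \<sqinter> y) \<sqinter> a = a \<sqinter> b \<sqinter> a"
    proof -
      have axa: "a \<sqinter> (x \<sqinter> a) = a" and aya: "a \<sqinter> (y \<sqinter> a) = a"
        using xy by (simp_all add: D_iff preord_ge_iff_meet meet_assoc)
      have "a \<sqinter> (x \<sqinter> b \<sqinter> y) \<sqinter> a = a \<sqinter> (x \<sqinter> (a \<sqinter> (b \<sqinter> y \<sqinter> a)))"
        using meet_regular[of a x "b \<sqinter> y"] by (simp add: meet_assoc)
      also have "\<dots> = (a \<sqinter> (x \<sqinter> a)) \<sqinter> (b \<sqinter> y \<sqinter> a)"
        by (simp add: meet_assoc)
      also have "\<dots> = a \<sqinter> (b \<sqinter> (a \<sqinter> (y \<sqinter> a)))"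
        unfolding axa using meet_regular[of a b y] by (simp add: meet_assoc)
      finally show ?thesis by (simp add: aya meet_assoc)
    qed
    ultimately show "(x \<sqinter> b \<sqinter> y, b) \<in> D \<and> a \<sqinter> (x \<sqinter> b \<sqinter> y) \<sqinter> a = a \<sqinter> b \<sqinter> a" ..
  qed
next
  show "?R \<subseteq> ?L"
  proof clarify
    fix d assume db: "(d, b) \<in> D" and eq: "a \<sqinter> d \<sqinter> a = a \<sqinter> b \<sqinter> a"
    define x where "x = d \<squnion> a \<squnion> d"
    have ad: "a \<succeq> d" using ab db by (auto simp: D_iff intro: preord_trans)
    have ax: "(a, x) \<in> D"
      unfolding x_def D_iff using ad
      by (meson join_ge1 join_ge2 join_least preord_refl preord_trans)
    have xa: "x \<sqinter> a \<sqinter> x = x" using ax by (simp add: D_iff D_meet_sandwich)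
    have *: "x \<sqinter> w \<sqinter> x = x \<sqinter> (a \<sqinter> w \<sqinter> a) \<sqinter> x" for w
      by (metis xa meet_assoc meet_regular)
    have "nat_ge x d" unfolding x_def by (rule nat_ge_join_conj)
    hence "d = x \<sqinter> d \<sqinter> x" by (simp add: nat_ge_def)
    also have "\<dots> = x \<sqinter> b \<sqinter> x" using *[of d] *[of b] eq by simp
    finally show "\<exists>x y. d = x \<sqinter> b \<sqinter> y \<and> x \<in> D `` {a} \<and> y \<in> D `` {a}" using ax by blast
  qed
qed

lemma join_coset_eq:
  assumes "a \<succeq> b"
  shows "{x \<squnion> a \<squnion> y | x y. x \<in> D `` {b} \<and> y \<in> D `` {b}}
    = {d. (d, a) \<in> D \<and> b \<squnion> d \<squnion> b = b \<squnion> a \<squnion> b}"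
  using skew_lattice.meet_coset_eq[OF dual, of b a] assms
  by (simp add: D_dual preord_ge_dual)

lemma meet_cosets_eq:
  assumes "a \<succeq> b"
  shows "meet_cosets (D `` {a}) (D `` {b})
    = {{d. (d, b') \<in> D \<and> a \<sqinter> d \<sqinter> a = a \<sqinter> b' \<sqinter> a} | b'. (b, b') \<in> D}"
proof -
  have "a \<succeq> b'" if "(b, b') \<in> D" for b'
    using assms that by (auto simp: D_iff intro: preord_trans)
  note eq = meet_coset_eq[OF this]
  show ?thesis
    unfolding meet_cosets_def
    by (rule Collect_cong, rule ex_cong1) (use eq in auto)
qed

lemma join_cosets_eq:
  assumes "a \<succeq> b"
  shows "join_cosets (D `` {b}) (D `` {a})
    = {{d. (d, a') \<in> D \<and> b \<squnion> d \<squnion> b = b \<squnion> a' \<squnion> b} | a'. (a, a') \<in> D}"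
proof -
  have "a' \<succeq> b" if "(a, a') \<in> D" for a'
    using assms that by (auto simp: D_iff intro: preord_trans)
  note eq = join_coset_eq[OF this]
  show ?thesis
    unfolding join_cosets_def
    by (rule Collect_cong, rule ex_cong1) (use eq in auto)
qed

lemma coset_bijections_eq:
  assumes "a \<succeq> b"
  shows "coset_bijections (D `` {a}) (D `` {b}) =
    {{(p, q). (p, a') \<in> D \<and> b \<squnion> p \<squnion> b = b \<squnion> a' \<squnion> b \<and>
              (q, b') \<in> D \<and> a \<sqinter> q \<sqinter> a = a \<sqinter> b' \<sqinter> a \<and> nat_gt p q}
     | a' b'. (a, a') \<in> D \<and> (b, b') \<in> D}"
proof -
  have "{F X Y | X Y. X \<in> {G a' | a'. P a'} \<and> Y \<in> {H b' | b'. Q b'}}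
      = {F (G a') (H b') | a' b'. P a' \<and> Q b'}"
    for F :: "'a set \<Rightarrow> 'a set \<Rightarrow> ('a \<times> 'a) set" and G H :: "'a \<Rightarrow> 'a set" and P Q
    by blast
  thus ?thesis
    unfolding coset_bijections_def meet_cosets_eq[OF assms] join_cosets_eq[OF assms]
    by (simp only: mem_Collect_eq conj_assoc)
qed

lemma D_refl: "(a, a) \<in> D"
  by (simp add: D_iff preord_refl)

lemma nat_ge_imp_class_gt: "nat_ge a b \<Longrightarrow> (a, b) \<notin> D \<Longrightarrow> class_gt (D `` {a}) (D `` {b})"
  unfolding class_gt_def
  by (auto simp: D_iff D_class_eq_iff dest!: nat_ge_imp_preord) (meson preord_trans)

section \<open>Strict categoricity and quasi-distributivity\<close>

text \<open>
  Strict categoricity speaks of proper chains only; when two of the three classes coincide,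
  the natural order is trivial on the common class and the claim is immediate.
\<close>

lemma strictly_categorical_middle_unique:
  assumes sc: strictly_categorical
    and ab: "nat_ge a b" and bc: "nat_ge b c" and ab': "nat_ge a b'" and b'c: "nat_ge b' c"
    and bb': "(b, b') \<in> D"
  shows "b = b'"
proof (cases "(a, b) \<in> D \<or> (b, c) \<in> D")
  case True
  thus ?thesis
    using ab bc ab' b'c bb' unfolding D_iff by (metis nat_ge_preord_eq preord_trans)
next
  case False
  have ac: "nat_ge a c" using ab bc by (rule nat_ge_trans)
  have nD: "(a, b) \<notin> D" "(b, c) \<notin> D" "(a, b') \<notin> D" "(b', c) \<notin> D" "(a, c) \<notin> D"
    using False bb' nat_ge_imp_preord[OF ab] nat_ge_imp_preord[OF bc]
    by (auto simp: D_iff intro: preord_trans)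
  have gt: "nat_gt a b'" "nat_gt b' c"
    using nD ab' b'c D_refl by (auto simp: nat_gt_def)
  have ge: "a \<succeq> b" "b \<succeq> c" "a \<succeq> c" using ab bc ac by (simp_all add: nat_ge_imp_preord)
  \<comment> \<open>the coset bijections through \<open>(a, b')\<close> and \<open>(b', c)\<close>\<close>
  define \<phi> where "\<phi> = {(p, q). (p, a) \<in> D \<and> b \<squnion> p \<squnion> b = b \<squnion> a \<squnion> b \<and>
              (q, b') \<in> D \<and> a \<sqinter> q \<sqinter> a = a \<sqinter> b' \<sqinter> a \<and> nat_gt p q}"
  define \<psi> where "\<psi> = {(p, q). (p, b') \<in> D \<and> c \<squnion> p \<squnion> c = c \<squnion> b' \<squnion> c \<and>
              (q, c) \<in> D \<and> b \<sqinter> q \<sqinter> b = b \<sqinter> c \<sqinter> b \<and> nat_gt p q}"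
  have \<phi>: "\<phi> \<in> coset_bijections (D `` {a}) (D `` {b})"
    unfolding coset_bijections_eq[OF ge(1)] \<phi>_def using bb' D_refl by blast
  have \<psi>: "\<psi> \<in> coset_bijections (D `` {b}) (D `` {c})"
    unfolding coset_bijections_eq[OF ge(2)] \<psi>_def using bb' D_refl by blast
  have "(a, c) \<in> \<phi> O \<psi>"
    using gt D_refl by (auto simp: \<phi>_def \<psi>_def)
  have classes: "D `` {a} \<in> D_classes" "D `` {b} \<in> D_classes" "D `` {c} \<in> D_classes"
    by (simp_all add: quotientI)
  have chain: "class_gt (D `` {a}) (D `` {b})" "class_gt (D `` {b}) (D `` {c})"
    using ab bc nD by (simp_all add: nat_ge_imp_class_gt)
  have "\<phi> O \<psi> \<in> coset_bijections (D `` {a}) (D `` {c})"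
    using sc classes chain \<phi> \<psi> \<open>(a, c) \<in> \<phi> O \<psi>\<close>
    unfolding strictly_categorical_def categorical_def by blast
  then obtain a1 c1 where comp: "\<phi> O \<psi> = {(p, q). (p, a1) \<in> D \<and> c \<squnion> p \<squnion> c = c \<squnion> a1 \<squnion> c \<and>
              (q, c1) \<in> D \<and> a \<sqinter> q \<sqinter> a = a \<sqinter> c1 \<sqinter> a \<and> nat_gt p q}"
      and a1: "(a, a1) \<in> D" and c1: "(c, c1) \<in> D"
    unfolding coset_bijections_eq[OF ge(3)] by blast
  have "c \<squnion> a \<squnion> c = c \<squnion> a1 \<squnion> c" "a \<sqinter> c \<sqinter> a = a \<sqinter> c1 \<sqinter> a"
    using \<open>(a, c) \<in> \<phi> O \<psi>\<close> unfolding comp by blast+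
  moreover have "c \<squnion> a \<squnion> c = a" using ac by (simp add: nat_ge_iff_join)
  moreover have "a \<sqinter> c \<sqinter> a = c" using ac by (simp add: nat_ge_def)
  ultimately have eqs: "c \<squnion> a1 \<squnion> c = a" "a \<sqinter> c1 \<sqinter> a = c" by metis+
  have "\<forall>Y\<in>meet_cosets (D `` {a}) (D `` {b}). \<forall>Z\<in>join_cosets (D `` {c}) (D `` {b}). Y \<inter> Z \<noteq> {}"
    using sc classes chain unfolding strictly_categorical_def by blast
  hence "{d. (d, b) \<in> D \<and> a \<sqinter> d \<sqinter> a = a \<sqinter> b \<sqinter> a} \<inter> {d. (d, b') \<in> D \<and> c \<squnion> d \<squnion> c = c \<squnion> b' \<squnion> c} \<noteq> {}"
    unfolding meet_cosets_eq[OF ge(1)] join_cosets_eq[OF ge(2)] using bb' D_refl by blast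
  then obtain u where u: "(u, b) \<in> D" "(u, b') \<in> D" "a \<sqinter> u \<sqinter> a = b" "c \<squnion> u \<squnion> c = b'"
    using ab b'c by (auto simp: nat_ge_def[of a b] nat_ge_iff_join[of b' c])
  \<comment> \<open>\<open>(p, q)\<close> will be a second pair in the composite, with \<open>q\<close> below \<open>u\<close>\<close>
  define q where "q = u \<sqinter> c \<sqinter> u"
  define p where "p = q \<squnion> a \<squnion> q"
  have uc: "u \<succeq> c" using u(1) ge(2) by (auto simp: D_iff intro: preord_trans)
  have uq: "nat_ge u q" unfolding q_def by (rule nat_ge_meet_conj)
  have qc: "(q, c) \<in> D"
    unfolding q_def using uc
    by (simp add: D_iff meet_greatest preord_refl) (meson meet_le1 meet_le2 preord_trans)
  have aqa: "a \<sqinter> q \<sqinter> a = c"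
  proof -
    have "a \<sqinter> q \<sqinter> a = (a \<sqinter> u \<sqinter> a) \<sqinter> c \<sqinter> (a \<sqinter> u \<sqinter> a)"
      unfolding q_def by (metis meet_assoc meet_regular)
    also have "\<dots> = c" using bc by (simp add: u nat_ge_def)
    finally show ?thesis .
  qed
  have pq: "nat_ge p q" unfolding p_def by (rule nat_ge_join_conj)
  have pa: "(p, a) \<in> D"
    unfolding p_def using qc ge(3)
    by (simp add: D_iff join_least preord_refl) (meson join_ge1 join_ge2 join_least preord_refl preord_trans)
  have cpc: "c \<squnion> p \<squnion> c = a"
  proof -
    have "c \<squnion> q \<squnion> c = c"
      using qc by (simp add: D_iff preord_ge_def)
    hence "c \<squnion> p \<squnion> c = c \<squnion> a \<squnion> c"
      unfolding p_def by (metis join_assoc join_regular)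
    thus ?thesis using ac by (simp add: nat_ge_iff_join)
  qed
  have "p \<noteq> q"
    using pa qc nD by (auto simp: D_iff intro: preord_trans)
  hence "(p, q) \<in> \<phi> O \<psi>"
    unfolding comp using pa a1 qc c1 pq aqa cpc eqs
    by (auto simp: D_iff nat_gt_def intro: preord_trans)
  then obtain v where v: "(v, b') \<in> D" "a \<sqinter> v \<sqinter> a = a \<sqinter> b' \<sqinter> a"
      "c \<squnion> v \<squnion> c = c \<squnion> b' \<squnion> c" "nat_ge v q"
    by (auto simp: \<phi>_def \<psi>_def nat_gt_def)
  \<comment> \<open>the coset of \<open>b'\<close> under the class of \<open>c\<close> has only one element above \<open>q\<close>\<close>
  have *: "w = q \<squnion> b' \<squnion> q" if "nat_ge w q" "c \<squnion> w \<squnion> c = b'" for w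
  proof -
    have qcq: "q \<squnion> c \<squnion> q = q" using qc by (simp add: D_iff preord_ge_def)
    have "w = q \<squnion> w \<squnion> q" using that by (simp add: nat_ge_iff_join)
    also have "\<dots> = q \<squnion> (c \<squnion> w \<squnion> c) \<squnion> q"
      using qcq by (metis join_assoc join_regular)
    finally show ?thesis using that by simp
  qed
  have "u = v"
    using *[OF uq] *[OF v(4)] u v b'c by (simp add: nat_ge_iff_join)
  thus "b = b'" using u v ab' by (simp add: nat_ge_def)
qed

lemma quasi_distributive_preord_cancel:
  assumes qd: quasi_distributive and yz: "y \<squnion> z \<succeq> x" and xz: "y \<succeq> x \<sqinter> z"
  shows "y \<succeq> x"
proof -
  have "class_meet (D `` {x}) (class_join (D `` {y}) (D `` {z}))
      = class_join (class_meet (D `` {x}) (D `` {y})) (class_meet (D `` {x}) (D `` {z}))"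
    using qd unfolding quasi_distributive_iff by (simp add: quotientI)
  hence "x \<sqinter> y \<squnion> x \<sqinter> z \<succeq> x \<sqinter> (y \<squnion> z)"
    by (simp add: class_meet_class class_join_class D_class_eq_iff)
  moreover have "x \<sqinter> (y \<squnion> z) \<succeq> x" using yz by (simp add: meet_greatest preord_refl)
  moreover have "y \<succeq> x \<sqinter> y \<squnion> x \<sqinter> z" using xz by (simp add: join_least meet_le2)
  ultimately show ?thesis by (meson preord_trans)
qed

end

section \<open>Skew lattices with unique middle elements\<close>

text \<open>
  Both assumptions are invariant under duality and mirror images, which strict categoricity
  does not show so directly. Hence each of the results below needs to be proved on one side only.
\<close>

locale unique_middle_skew_lattice = skew_lattice +
  assumes middle_unique: "\<lbrakk>nat_ge a b; nat_ge b c; nat_ge a b'; nat_ge b' c; b \<succeq> b'; b' \<succeq> b\<rbrakk> \<Longrightarrow> b = b'"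
    and preord_cancel: "\<lbrakk>y \<squnion> z \<succeq> x; y \<succeq> x \<sqinter> z\<rbrakk> \<Longrightarrow> y \<succeq> x"
begin

lemma unique_middle_dual: "unique_middle_skew_lattice (\<squnion>) (\<sqinter>)"
  by (intro unique_middle_skew_lattice.intro dual, unfold_locales)
    (unfold preord_ge_dual nat_ge_dual,
     blast intro: middle_unique,
     meson preord_cancel join_least join_ge1 join_ge2 meet_greatest meet_le1 meet_le2 preord_trans)

lemma unique_middle_mirror: "unique_middle_skew_lattice (\<lambda>x y. y \<sqinter> x) (\<lambda>x y. y \<squnion> x)"
  by (intro unique_middle_skew_lattice.intro mirror, unfold_locales)
    (unfold preord_ge_mirror nat_ge_mirror,
     blast intro: middle_unique,
     meson preord_cancel join_least join_ge1 join_ge2 meet_greatest meet_le1 meet_le2 preord_trans)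

text \<open>
  The two sides are squeezed between \<open>x\<close> and \<open>x \<sqinter> z \<sqinter> y \<sqinter> x\<close>; the reversed order of \<open>y\<close> and \<open>z\<close>
  matters, since \<open>y \<squnion> z\<close> lies above \<open>z \<sqinter> y\<close> but in general not above \<open>y \<sqinter> z\<close>.
\<close>

lemma meet_distributes:
  "x \<sqinter> (y \<squnion> z) \<sqinter> x = (x \<sqinter> y \<sqinter> x) \<squnion> (x \<sqinter> z \<sqinter> x)" (is "?m = ?n")
proof (rule middle_unique)
  show "nat_ge x ?m" by (rule nat_ge_meet_conj)
  show "nat_ge x ?n"
    using nat_ge_meet_conj[of x y] nat_ge_meet_conj[of x z]
    unfolding nat_ge_iff_join by (metis join_assoc)
  have join_ge_meet: "nat_ge (u \<squnion> v) (v \<sqinter> u)" for u v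
    unfolding nat_ge_def by (metis meet_assoc meet_join_absorb join_meet_absorb_right)
  show "nat_ge ?m (x \<sqinter> (z \<sqinter> y) \<sqinter> x)"
    using join_ge_meet[of y z] unfolding nat_ge_def by (metis meet_assoc meet_regular)
  have "x \<sqinter> (z \<sqinter> y) \<sqinter> x = (x \<sqinter> z \<sqinter> x) \<sqinter> (x \<sqinter> y \<sqinter> x)"
    by (simp add: meet_assoc meet_left_idem meet_regular)
  thus "nat_ge ?n (x \<sqinter> (z \<sqinter> y) \<sqinter> x)" using join_ge_meet by simp
  show "?m \<succeq> ?n"
    by (meson join_least join_ge1 join_ge2 meet_mono preord_refl)
  show "?n \<succeq> ?m"
  proof (rule preord_cancel)
    show "?n \<squnion> z \<succeq> ?m"
    proof (rule preord_cancel)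
      show "?n \<squnion> z \<squnion> y \<succeq> ?m"
        by (meson join_least join_ge1 join_ge2 meet_le1 meet_le2 preord_trans)
      show "?n \<squnion> z \<succeq> ?m \<sqinter> y"
        by (meson join_ge1 meet_greatest meet_le1 meet_le2 preord_trans)
    qed
    show "?n \<succeq> ?m \<sqinter> z"
      by (meson join_ge2 meet_greatest meet_le1 meet_le2 preord_trans)
  qed
qed

lemma distributive: distributive
  unfolding distributive_def
  using meet_distributes unique_middle_skew_lattice.meet_distributes[OF unique_middle_dual] by blast

lemma simply_cancellative: simply_cancellative
  unfolding simply_cancellative_def
proof (intro allI impI, elim conjE)
  have ge: "y \<succeq> x" if "x \<squnion> z \<squnion> x = y \<squnion> z \<squnion> y" "x \<sqinter> z \<sqinter> x = y \<sqinter> z \<sqinter> y" for x y z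
  proof (rule preord_cancel)
    have "y \<squnion> z \<succeq> x \<squnion> z \<squnion> x" unfolding that by (meson join_ge1 join_ge2 join_least)
    thus "y \<squnion> z \<succeq> x" by (meson join_ge2 preord_trans)
    have "x \<sqinter> z \<sqinter> x \<succeq> x \<sqinter> z" by (meson meet_le1 meet_le2 meet_greatest)
    thus "y \<succeq> x \<sqinter> z" unfolding that by (meson meet_le2 preord_trans)
  qed
  fix x y z
  assume j: "x \<squnion> z \<squnion> x = y \<squnion> z \<squnion> y" and m: "x \<sqinter> z \<sqinter> x = y \<sqinter> z \<sqinter> y"
  show "x = y"
  proof (rule middle_unique)
    show "nat_ge (x \<squnion> z \<squnion> x) x" "nat_ge x (x \<sqinter> z \<sqinter> x)"
      by (rule nat_ge_join_conj nat_ge_meet_conj)+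
    show "nat_ge (x \<squnion> z \<squnion> x) y" "nat_ge y (x \<sqinter> z \<sqinter> x)"
      unfolding j m by (rule nat_ge_join_conj nat_ge_meet_conj)+
    show "x \<succeq> y" "y \<succeq> x" by (rule ge[OF j[symmetric] m[symmetric]] ge[OF j m])+
  qed
qed

text \<open>
  Only half of \<open>y = z\<close> is obtained at this stage: multiplying by \<open>s = x \<squnion> y\<close> to bring \<open>y\<close> and \<open>z\<close>
  below \<open>s\<close> loses information on one side. The dual statement recovers the other half.
\<close>

lemma equal_joins_meets_absorb:
  assumes sym: symmetric and j: "x \<squnion> y = x \<squnion> z" and m: "x \<sqinter> y = x \<sqinter> z"
  shows "y = z \<sqinter> y"
proof -
  define s where "s = x \<squnion> y"
  have xs: "x \<sqinter> s = x" and sy: "s \<sqinter> y = y" and sz: "s \<sqinter> z = z"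
    unfolding s_def using meet_join_absorb join_meet_absorb_right j by metis+
  have below: "nat_ge s (y' \<sqinter> s)" "nat_ge (y' \<sqinter> s) (s \<sqinter> (x \<sqinter> y') \<sqinter> s)"
    if sy': "s \<sqinter> y' = y'" and s: "s = x \<squnion> y'" for y'
  proof -
    \<comment> \<open>\<open>s \<sqinter> x\<close> and \<open>y' \<sqinter> s\<close> are representatives of the classes of \<open>x\<close> and \<open>y'\<close> below \<open>s\<close>;
      both of their joins are below \<open>s\<close> and in its class, so both equal \<open>s\<close>\<close>
    show sy2: "nat_ge s (y' \<sqinter> s)"
      unfolding nat_ge_def by (metis meet_assoc meet_idem sy')
    have sx: "nat_ge s (s \<sqinter> x)"
      unfolding nat_ge_def by (metis meet_assoc meet_idem xs)
    have "(s \<sqinter> x) \<succeq> x" "(y' \<sqinter> s) \<succeq> y'"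
      unfolding preord_ge_iff_meet using xs sy' by (metis meet_assoc meet_idem)+
    hence "(s \<sqinter> x) \<squnion> (y' \<sqinter> s) \<succeq> s" "(y' \<sqinter> s) \<squnion> (s \<sqinter> x) \<succeq> s"
      unfolding s by (meson join_ge1 join_ge2 join_least preord_trans)+
    hence "(s \<sqinter> x) \<squnion> (y' \<sqinter> s) = (y' \<sqinter> s) \<squnion> (s \<sqinter> x)"
      using nat_ge_join_least sx sy2 nat_ge_preord_eq by metis
    hence "(s \<sqinter> x) \<sqinter> (y' \<sqinter> s) = (y' \<sqinter> s) \<sqinter> (s \<sqinter> x)"
      using sym unfolding symmetric_def by blast
    thus "nat_ge (y' \<sqinter> s) (s \<sqinter> (x \<sqinter> y') \<sqinter> s)"
      unfolding nat_ge_def by (metis meet_assoc meet_idem)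
  qed
  have ge: "y' \<succeq> z'" if j': "x \<squnion> y' = x \<squnion> z'" and m': "x \<sqinter> y' = x \<sqinter> z'" for y' z'
  proof (rule preord_cancel)
    have "y' \<squnion> x \<succeq> x \<squnion> y'" by (meson join_ge1 join_ge2 join_least)
    thus "y' \<squnion> x \<succeq> z'" unfolding j' by (meson join_ge2 preord_trans)
    have "x \<sqinter> z' \<succeq> z' \<sqinter> x" by (meson meet_le1 meet_le2 meet_greatest)
    thus "y' \<succeq> z' \<sqinter> x" unfolding m'[symmetric] by (meson meet_le2 preord_trans)
  qed
  have y_ge: "y \<succeq> z" and z_ge: "z \<succeq> y"
    by (rule ge[OF j m] ge[OF j[symmetric] m[symmetric]])+
  have "y \<sqinter> s = z \<sqinter> s"
  proof (rule middle_unique)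
    show "nat_ge s (y \<sqinter> s)" "nat_ge (y \<sqinter> s) (s \<sqinter> (x \<sqinter> y) \<sqinter> s)"
      using below[OF sy] s_def by simp_all
    show "nat_ge s (z \<sqinter> s)" "nat_ge (z \<sqinter> s) (s \<sqinter> (x \<sqinter> y) \<sqinter> s)"
      using below[OF sz] s_def j m by simp_all
    show "y \<sqinter> s \<succeq> z \<sqinter> s" "z \<sqinter> s \<succeq> y \<sqinter> s"
      using y_ge z_ge by (simp_all add: meet_mono preord_refl)
  qed
  hence "y \<sqinter> (s \<sqinter> y) = z \<sqinter> (s \<sqinter> y)" by (simp flip: meet_assoc)
  thus ?thesis by (simp add: sy meet_idem)
qed


lemma left_cancel:
  assumes sym: symmetric and j: "x \<squnion> y = x \<squnion> z" and m: "x \<sqinter> y = x \<sqinter> z"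
  shows "y = z"
proof -
  have "skew_lattice.symmetric (\<squnion>) (\<sqinter>)"
    using sym unfolding skew_lattice.symmetric_def[OF dual] symmetric_def by blast
  hence "y = z \<squnion> y"
    using unique_middle_skew_lattice.equal_joins_meets_absorb[OF unique_middle_dual] m j by blast
  moreover have "y = z \<sqinter> y" using equal_joins_meets_absorb assms .
  ultimately show ?thesis by (metis join_meet_absorb)
qed

lemma symmetric_imp_cancellative:
  assumes sym: symmetric
  shows cancellative
proof -
  have "skew_lattice.symmetric (\<lambda>x y. y \<sqinter> x) (\<lambda>x y. y \<squnion> x)"
    using sym unfolding skew_lattice.symmetric_def[OF mirror] symmetric_def by metis
  note right_cancel = unique_middle_skew_lattice.left_cancel[OF unique_middle_mirror this]
  show ?thesis
    unfolding cancellative_def using left_cancel[OF sym] right_cancel by blast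
qed

end

section \<open>Cancellation implies symmetry\<close>

context skew_lattice
begin

lemma cancellative_dual: "skew_lattice.cancellative (\<squnion>) (\<sqinter>) \<longleftrightarrow> cancellative"
  unfolding skew_lattice.cancellative_def[OF dual] cancellative_def by blast

lemma cancellative_mirror:
  "skew_lattice.cancellative (\<lambda>x y. y \<sqinter> x) (\<lambda>x y. y \<squnion> x) \<longleftrightarrow> cancellative"
  unfolding skew_lattice.cancellative_def[OF mirror] cancellative_def by blast

text \<open>
  The element \<open>w = y \<sqinter> (x \<squnion> y)\<close> is below \<open>x \<squnion> y\<close> and has the same meet and join with \<open>x\<close> on the left
  as \<open>y\<close> does, so that \<open>w = y\<close>.
\<close>

lemma cancellative_commuting_below_join:
  assumes canc: cancellative and comm: "x \<sqinter> y = y \<sqinter> x"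
  shows "nat_ge (x \<squnion> y) y"
proof -
  define s where "s = x \<squnion> y"
  define w where "w = y \<sqinter> s"
  have xs: "x \<sqinter> s = x" and sy: "s \<sqinter> y = y"
    by (simp_all add: s_def meet_join_absorb join_meet_absorb_right)
  have "x \<sqinter> w = y \<sqinter> (x \<sqinter> s)"
    unfolding w_def using comm by (simp flip: meet_assoc)
  hence m: "x \<sqinter> w = x \<sqinter> y" using xs comm by simp
  have yw: "y \<squnion> w = y" by (simp add: w_def join_meet_absorb)
  have "w \<sqinter> y = y" by (simp add: w_def meet_assoc sy meet_idem)
  hence wy: "w \<squnion> y = w" by (metis join_meet_absorb)
  have sw: "nat_ge s w"
    unfolding nat_ge_def w_def by (metis meet_assoc meet_idem sy)
  have "y \<squnion> x \<squnion> w = y \<squnion> x \<squnion> (w \<squnion> y)" using wy by simp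
  also have "\<dots> = y \<squnion> x \<squnion> (y \<squnion> w \<squnion> y)"
    using join_regular[of y x w] by (simp add: join_assoc)
  also have "\<dots> = y \<squnion> x \<squnion> y" by (simp add: yw join_idem)
  finally have "x \<squnion> y \<squnion> x \<squnion> w = (x \<squnion> y) \<squnion> (x \<squnion> y)" by (simp add: join_assoc)
  hence sxw: "s \<squnion> (x \<squnion> w) = s" by (simp add: s_def join_idem join_assoc)
  have xws: "(x \<squnion> w) \<squnion> s = s"
  proof -
    have "(x \<squnion> w) \<squnion> s = x \<squnion> (w \<squnion> s)" by (rule join_assoc)
    also have "\<dots> = x \<squnion> s" using sw by (simp add: nat_ge_iff_join)
    also have "\<dots> = s" by (simp add: s_def join_idem flip: join_assoc)
    finally show ?thesis .
  qed
  have "w \<succeq> y" unfolding preord_ge_def by (simp add: wy join_idem)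
  hence "x \<squnion> w \<succeq> s" unfolding s_def by (meson join_mono preord_refl)
  hence "s = x \<squnion> w"
    using sxw xws by (intro nat_ge_preord_eq) (simp_all add: nat_ge_iff_join)
  hence "y = w"
    using canc m unfolding cancellative_def s_def by metis
  thus ?thesis using sw s_def by simp
qed

lemma cancellative_imp_joins_commute:
  assumes canc: cancellative and comm: "x \<sqinter> y = y \<sqinter> x"
  shows "x \<squnion> y = y \<squnion> x"
proof -
  have "nat_ge (x \<squnion> y) y" by (rule cancellative_commuting_below_join[OF assms])
  moreover have "nat_ge (x \<squnion> y) x"
    using skew_lattice.cancellative_commuting_below_join[OF mirror, where x=y and y=x] canc comm
    by (simp add: cancellative_mirror nat_ge_mirror)
  ultimately have "nat_ge (x \<squnion> y) (y \<squnion> x)" by (simp add: nat_ge_join_least)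
  moreover have "y \<squnion> x \<succeq> x \<squnion> y" by (meson join_ge1 join_ge2 join_least)
  ultimately show ?thesis by (rule nat_ge_preord_eq)
qed

lemma cancellative_imp_symmetric: "cancellative \<Longrightarrow> symmetric"
  unfolding symmetric_def
  using cancellative_imp_joins_commute
    skew_lattice.cancellative_imp_joins_commute[OF dual] cancellative_dual by blast

end

theorem theorem5p1:
  fixes meet join :: "'a \<Rightarrow> 'a \<Rightarrow> 'a"
  assumes "skew_lattice meet join"
    and "skew_lattice.strictly_categorical meet join"
    and "skew_lattice.quasi_distributive meet join"
  shows "(skew_lattice.distributive meet join \<and> skew_lattice.simply_cancellative meet join) \<and>
    (skew_lattice.cancellative meet join \<longleftrightarrow> skew_lattice.symmetric meet join)"
proof -
  interpret skew_lattice meet join by fact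
  interpret unique_middle_skew_lattice meet join
  proof unfold_locales
    show "b = b'"
      if "nat_ge a b" "nat_ge b c" "nat_ge a b'" "nat_ge b' c" "preord_ge b b'" "preord_ge b' b"
      for a b b' c
      using strictly_categorical_middle_unique[OF assms(2) that(1-4)] that(5,6)
      by (simp add: D_iff)
    show "preord_ge y x" if "preord_ge (join y z) x" "preord_ge y (meet x z)" for x y z
      using quasi_distributive_preord_cancel[OF assms(3) that] .
  qed
  show ?thesis
    using distributive simply_cancellative cancellative_imp_symmetric symmetric_imp_cancellative
    by blast
qed

end
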